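(* The Strong Uniqueness Conjecture implies the Uniqueness Conjecture. That is, assume the following statement (S); then statement (U) holds. (S) For all integers $k,m,n$ with $m\ge0$, $n\ge 0$ and all $a_0,\ldots,a_n\in\mathbb{Q}$: if $$\binom{kp-1}{p-1}\equiv a_0+a_1\,p\,H(\{1\}^1;p-1)+\cdots+a_n\,p^nH(\{1\}^n;p-1)\pmod{p^m}$$ holds for all but finitely many primes $p$, then there are constants $c_0,c_1,\ldots\in\mathbb{Q}$ such that, with $$b_j=(k-1)^j+c_j+(-1)^{j+1}\sum_{i=0}^{j}\binom{j}{i}c_i\qquad(j\ge0),$$ one has $a_i=b_i$ for $i=0,1,\ldots,\psi(m)$, where $\psi(m)=m-2$ if $m$ is even, $\psi(m)=m-3$ if $m$ is odd, and $a_i=0$ for $i>n$ by convention. (U) For all integers $n\ge0$ and $k$ and all $b_0,\ldots,b_n\in\mathbb{Q}$: if $$\binom{kp-1}{p-1}\equiv\sum_{j=0}^{n}b_j\,p^jH(\{1\}^j;p-1)\pmod{p^{2n+2}}$$ holds for all sufficiently large primes $p$, then $b_j=b_{j,n}(k)$ for $j=0,1,\ldots,n$.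
   Context: For non-negative integers $j,m$, the elementary symmetric multiple harmonic sum is $H(\{1\}^j;m)=\sum_{m\ge i_1>i_2>\cdots>i_j\ge 1}\frac{1}{i_1 i_2\cdots i_j}\in\mathbb{Q}$, with $H(\{1\}^0;m)=1$ and $H(\{1\}^j;m)=0$ if $j>m$. For integers $0\le j\le n$, the extremal polynomial $b_{j,n}(T)\in\mathbb{Q}[T]$ is the unique polynomial of degree at most $2n+1$ satisfying $b_{j,n}(T)\equiv (T-1)^j \pmod{(T-1)^{n+1}}$ and $b_{j,n}(T)\equiv (-1)^jT^j\pmod{T^{n+1}}$ in $\mathbb{Q}[T]$. For an arbitrary integer $x$, $\binom{x}{m}=x(x-1)\cdots(x-m+1)/m!$, and $(k-1)^0=1$. For rational numbers, $x\equiv y\pmod{p^m}$ means $x-y$ has $p$-adic valuation at least $m$. *)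

theory Defs
  imports
    "HOL-Number_Theory.Cong"
    "HOL-Computational_Algebra.Computational_Algebra"
begin

definition elem_harmonic :: "nat \<Rightarrow> nat \<Rightarrow> rat" where
  "elem_harmonic j m =
     (\<Sum>is | length is = j \<and> sorted_wrt (>) is \<and> set is \<subseteq> {1..m}. \<Prod>i\<leftarrow>is. 1 / of_nat i)"

text \<open>The index set is finite, so the sum does not collapse to the default value 0.\<close>

lemma finite_elem_harmonic_indices:
  "finite {is :: nat list. length is = j \<and> sorted_wrt (>) is \<and> set is \<subseteq> {1..m}}"
  by (rule finite_subset[OF _ finite_lists_length_eq[of "{1..m}" j]]) auto

lemma elem_harmonic_0: "elem_harmonic 0 m = 1"
proof -
  have "{is :: nat list. length is = 0 \<and> sorted_wrt (>) is \<and> set is \<subseteq> {1..m}} = {[]}"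
    by auto
  then show ?thesis
    by (simp add: elem_harmonic_def)
qed

lemma elem_harmonic_eq_0:
  assumes "m < j"
  shows "elem_harmonic j m = 0"
proof -
  have "length is \<le> m" if "sorted_wrt (>) is" "set is \<subseteq> {1..m}" for "is" :: "nat list"
  proof -
    have "distinct is"
      using that(1) by (induction "is") auto
    then have "length is = card (set is)"
      by (simp add: distinct_card)
    also have "\<dots> \<le> card {1..m}"
      using that(2) by (intro card_mono) auto
    finally show ?thesis by simp
  qed
  then have "{is :: nat list. length is = j \<and> sorted_wrt (>) is \<and> set is \<subseteq> {1..m}} = {}"
    using assms by (auto simp: not_le[symmetric])
  then show ?thesis
    unfolding elem_harmonic_def by (simp only: sum.empty)
qed

text \<open>Only meaningful for \<open>x \<noteq> 0\<close>; the infinite valuation of 0 is treated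
  separately in \<open>rat_cong\<close>.\<close>

definition padic_val :: "nat \<Rightarrow> rat \<Rightarrow> int" where
  "padic_val p x =
     int (multiplicity (int p) (fst (quotient_of x))) -
     int (multiplicity (int p) (snd (quotient_of x)))"

definition rat_cong :: "nat \<Rightarrow> nat \<Rightarrow> rat \<Rightarrow> rat \<Rightarrow> bool" where
  "rat_cong p m x y \<longleftrightarrow> x = y \<or> padic_val p (x - y) \<ge> int m"

definition extremal_poly :: "nat \<Rightarrow> nat \<Rightarrow> rat poly" where
  "extremal_poly j n =
     (THE b. degree b \<le> 2 * n + 1 \<and>
             [b = [:-1, 1:] ^ j] (mod [:-1, 1:] ^ (n + 1)) \<and>
             [b = (-1) ^ j * [:0, 1:] ^ j] (mod [:0, 1:] ^ (n + 1)))"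

definition binomial_congruence :: "int \<Rightarrow> nat \<Rightarrow> nat \<Rightarrow> (nat \<Rightarrow> rat) \<Rightarrow> nat \<Rightarrow> bool" where
  "binomial_congruence k m n a p \<longleftrightarrow>
     rat_cong p m (of_int (k * int p - 1) gchoose (p - 1))
       (\<Sum>j\<le>n. a j * of_nat p ^ j * elem_harmonic j (p - 1))"

text \<open>Integer-valued, since \<open>\<psi>(0) = \<psi>(1) = -2\<close>.\<close>

definition psi :: "nat \<Rightarrow> int" where
  "psi m = (if even m then int m - 2 else int m - 3)"

definition strong_uniqueness_conjecture :: bool where
  "strong_uniqueness_conjecture \<longleftrightarrow>
     (\<forall>(k :: int) (m :: nat) (n :: nat) (a :: nat \<Rightarrow> rat).
        finite {p. prime p \<and> \<not> binomial_congruence k m n a p} \<longrightarrow>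
        (\<exists>c :: nat \<Rightarrow> rat. \<forall>j :: nat. int j \<le> psi m \<longrightarrow>
           (if j \<le> n then a j else 0) =
             (of_int k - 1) ^ j + c j + (-1) ^ (j + 1) * (\<Sum>i\<le>j. of_nat (j choose i) * c i)))"

definition uniqueness_conjecture :: bool where
  "uniqueness_conjecture \<longleftrightarrow>
     (\<forall>(n :: nat) (k :: int) (b :: nat \<Rightarrow> rat).
        (\<exists>N. \<forall>p\<ge>N. prime p \<longrightarrow> binomial_congruence k (2 * n + 2) n b p) \<longrightarrow>
        (\<forall>j\<le>n. b j = poly (extremal_poly j n) (of_int k)))"

end

theory Submission
  imports Defs "HOL-Computational_Algebra.Field_as_Ring"
begin

text \<open>
  Given the constants \<open>c\<close> of the strong conjecture for modulus exponent \<open>2 * n + 2\<close>, let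
  \<open>L(T ^ j) = c j\<close> and \<open>M(T ^ j) = b j\<close> (with \<open>b j = 0\<close> for \<open>n < j \<le> 2 * n\<close>) define linear
  functionals on polynomials of degree at most \<open>2 * n\<close>. The strong conjecture says
  \<open>M f = f (k - 1) + L f - L (f \<circ> \<sigma>)\<close> for the involution \<open>\<sigma> T = - 1 - T\<close>, so \<open>M\<close> is evaluation
  at \<open>k - 1\<close> on \<open>\<sigma>\<close>-invariant polynomials. By uniqueness the extremal polynomial is invariant
  under \<open>T \<mapsto> 1 - T\<close>; hence it has degree at most \<open>2 * n\<close>, its translate \<open>B\<close> by 1 is
  \<open>\<sigma>\<close>-invariant, and \<open>B\<close> agrees with \<open>T ^ j\<close> modulo \<open>T ^ (n + 1)\<close>. Thus
  \<open>b j = M B = B (k - 1)\<close>, which is the value of the extremal polynomial at \<open>k\<close>.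
\<close>

lemma pcompose_power: "pcompose (p ^ n) q = pcompose p q ^ n"
  for p q :: "'a::comm_semiring_1 poly"
  by (induction n) (simp_all add: pcompose_mult pcompose_1)

lemma pcompose_sum_of_powers:
  fixes p q :: "'a::comm_ring_1 poly"
  assumes "degree p \<le> N"
  shows "pcompose p q = (\<Sum>i\<le>N. smult (coeff p i) (q ^ i))"
proof -
  have "p = (\<Sum>i\<le>N. monom (coeff p i) i)"
    using assms by (rule poly_as_sum_of_monoms'[symmetric])
  then have "pcompose p q = (\<Sum>i\<le>N. pcompose (monom (coeff p i) i) q)"
    by (metis pcompose_sum)
  also have "\<dots> = (\<Sum>i\<le>N. smult (coeff p i) (q ^ i))"
    by (simp add: monom_altdef pcompose_smult pcompose_power pcompose_pCons)
  finally show ?thesis .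
qed

text \<open>Since \<open>[:-1, -1:]\<close> is -(1 + T), this is the binomial theorem. It turns the
  signed binomial sums of the strong conjecture into coefficients of powers of \<sigma>.\<close>

lemma coeff_reflection_power:
  "coeff ([:-1, -1:] ^ j :: 'a::comm_ring_1 poly) i = (-1) ^ j * of_nat (j choose i)"
proof (cases "i \<le> j")
  case True
  then have "(-1) ^ i * (-1) ^ (j - i) = ((-1) ^ j :: 'a)"
    by (simp flip: power_add)
  then show ?thesis
    using True by (simp add: coeff_linear_poly_power mult.assoc mult.commute[of _ "of_nat _"])
next
  case False
  have "degree ([:-1, -1:] ^ j :: 'a poly) \<le> j"
    using degree_power_le[of "[:-1, -1:] :: 'a poly" j] by simp
  with False show ?thesis
    by (simp add: coeff_eq_0 binomial_eq_0)
qed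

text \<open>Bezout coefficients yield a solution and reduction modulo \<open>p * q\<close> bounds
  its degree. Two such solutions differ by a multiple of \<open>p * q\<close> of smaller degree,
  hence by 0.\<close>

lemma ex1_poly_chinese_remainder:
  fixes p q u v :: "'a::field_gcd poly"
  assumes "coprime p q" "degree p + degree q > 0" "p \<noteq> 0" "q \<noteq> 0"
  shows "\<exists>!b. degree b < degree p + degree q \<and> [b = u] (mod p) \<and> [b = v] (mod q)"
proof -
  obtain r s where rs: "r * p + s * q = 1"
    using bezout_coefficients[of p q] assms(1)
    by (metis coprime_imp_gcd_eq_1 prod.exhaust)
  \<comment> \<open>\<open>r * p\<close> is 0 modulo \<open>p\<close> and 1 modulo \<open>q\<close>;
    \<open>s * q\<close> is the reverse.\<close>
  define w where "w = (v * r * p + u * s * q) mod (p * q)"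
  have "w - u = (v - u) * r * p - (v * r * p + u * s * q) div (p * q) * (p * q)"
  proof -
    have "u = u * (r * p + s * q)" using rs by simp
    then show ?thesis
      unfolding w_def minus_div_mult_eq_mod[symmetric] by (simp add: algebra_simps)
  qed
  then have w1: "p dvd w - u" by simp
  have "w - v = (u - v) * s * q - (v * r * p + u * s * q) div (p * q) * (p * q)"
  proof -
    have "v = v * (r * p + s * q)" using rs by simp
    then show ?thesis
      unfolding w_def minus_div_mult_eq_mod[symmetric] by (simp add: algebra_simps)
  qed
  then have w2: "q dvd w - v" by simp
  have deg: "degree (p * q) = degree p + degree q"
    using assms by (simp add: degree_mult_eq)
  \<comment> \<open>The remainder may be 0, of degree 0; positivity of the degree sum covers that
    case.\<close>
  have w3: "degree w < degree p + degree q"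
    using degree_mod_less[of "p * q" "v * r * p + u * s * q"] assms deg
    unfolding w_def by auto
  show ?thesis
  proof (rule ex1I[of _ w])
    show "degree w < degree p + degree q \<and> [w = u] (mod p) \<and> [w = v] (mod q)"
      using w1 w2 w3 by (simp add: cong_iff_dvd_diff)
  next
    fix b
    assume b: "degree b < degree p + degree q \<and> [b = u] (mod p) \<and> [b = v] (mod q)"
    then have "p dvd b - w" "q dvd b - w"
      using w1 w2 unfolding cong_iff_dvd_diff
      by (metis dvd_diff diff_diff_eq2 diff_add_cancel)+
    then have "p * q dvd b - w"
      using assms(1) by (rule divides_mult)
    moreover have "degree (b - w) < degree (p * q)"
      using b w3 deg by (simp add: degree_diff_less)
    ultimately show "b = w"
      by (metis dvd_imp_degree_le eq_iff_diff_eq_0 not_le)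
  qed
qed

lemma coprime_powers_of_X_minus_1_and_X: "coprime ([:-1, 1:] ^ m) ([:0, 1:] ^ n :: rat poly)"
proof -
  have "coprime [:-1, 1:] ([:0, 1:] :: rat poly)"
  proof (rule coprimeI)
    fix d :: "rat poly"
    assume "d dvd [:-1, 1:]" "d dvd [:0, 1:]"
    then have "d dvd [:0, 1:] - [:-1, 1:]" by (rule dvd_diff[rotated])
    then show "is_unit d" by (simp add: one_pCons)
  qed
  then show ?thesis by simp
qed

definition is_extremal :: "nat \<Rightarrow> nat \<Rightarrow> rat poly \<Rightarrow> bool" where
  "is_extremal j n b \<longleftrightarrow>
     degree b \<le> 2 * n + 1 \<and>
     [b = [:-1, 1:] ^ j] (mod [:-1, 1:] ^ (n + 1)) \<and>
     [b = (-1) ^ j * [:0, 1:] ^ j] (mod [:0, 1:] ^ (n + 1))"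

lemma ex1_is_extremal: "\<exists>!b. is_extremal j n b"
proof -
  have "degree ([:-1, 1:] ^ (n + 1) :: rat poly) + degree ([:0, 1:] ^ (n + 1) :: rat poly)
          = 2 * n + 2"
    by (simp add: degree_power_eq del: power_Suc)
  then show ?thesis
    using ex1_poly_chinese_remainder[OF coprime_powers_of_X_minus_1_and_X[of "n + 1" "n + 1"],
        of "[:-1, 1:] ^ j" "(-1) ^ j * [:0, 1:] ^ j"]
    by (simp add: is_extremal_def less_Suc_eq_le del: power_Suc)
qed

lemma is_extremal_extremal_poly: "is_extremal j n (extremal_poly j n)"
  using theI'[OF ex1_is_extremal[of j n]]
  unfolding extremal_poly_def is_extremal_def .

text \<open>The substitution sends T - 1 to -T and T to -(T - 1), so it exchanges the two
  congruences; the factor \<open>(-1) ^ j\<close> absorbs the sign.\<close>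

lemma is_extremal_reflect:
  assumes "is_extremal j n b"
  shows "is_extremal j n (pcompose b [:1, -1:])"
proof -
  let ?r = "[:1, -1:] :: rat poly"
  have r: "pcompose [:-1, 1:] ?r = - [:0, 1:]" "pcompose [:0, 1:] ?r = - [:-1, 1:]"
    by (simp_all add: pcompose_pCons)
  obtain g h where
    g: "b = [:-1, 1:] ^ j + [:-1, 1:] ^ (n + 1) * g" and
    h: "b = (-1) ^ j * [:0, 1:] ^ j + [:0, 1:] ^ (n + 1) * h"
    using assms unfolding is_extremal_def cong_iff_dvd_diff
    by (metis add_diff_cancel_left' diff_add_cancel add.commute dvdE)
  have neg1: "pcompose (-1) q = -1" for q :: "rat poly"
    by (simp add: pcompose_uminus pcompose_1)
  have "pcompose b ?r = (- [:0, 1:]) ^ j + (- [:0, 1:]) ^ (n + 1) * pcompose g ?r"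
    by (subst g) (simp only: pcompose_add pcompose_mult pcompose_power r)
  then have X: "[:0, 1:] ^ (n + 1) dvd pcompose b ?r - (-1) ^ j * [:0, 1:] ^ j"
    by (simp add: power_minus[of "[:0, 1:] :: rat poly"] del: power_Suc minus_pCons)
  have "pcompose b ?r =
      (-1) ^ j * (- [:-1, 1:]) ^ j + (- [:-1, 1:]) ^ (n + 1) * pcompose h ?r"
    by (subst h) (simp only: pcompose_add pcompose_mult pcompose_power r neg1)
  moreover have "(-1) ^ j * (- q) ^ j = q ^ j" for q :: "rat poly"
    by (simp flip: power_mult_distrib)
  ultimately have "pcompose b ?r - [:-1, 1:] ^ j = (- [:-1, 1:]) ^ (n + 1) * pcompose h ?r"
    by (simp only: add_diff_cancel_left')
  moreover have "q ^ (n + 1) dvd (- q) ^ (n + 1)" for q :: "rat poly"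
    by (simp only: power_minus[of q] dvd_triv_right)
  ultimately have "[:-1, 1:] ^ (n + 1) dvd pcompose b ?r - [:-1, 1:] ^ j"
    by (simp only: dvd_mult2)
  then show ?thesis
    using X assms
    by (simp add: is_extremal_def cong_iff_dvd_diff degree_pcompose del: power_Suc)
qed

lemma extremal_poly_reflect: "pcompose (extremal_poly j n) [:1, -1:] = extremal_poly j n"
  using ex1_is_extremal is_extremal_extremal_poly is_extremal_reflect by blast

text \<open>In the odd degree 2n + 1 the reflection negates the leading coefficient, so invariance
  would force it to be 0.\<close>

lemma degree_extremal_poly: "degree (extremal_poly j n) \<le> 2 * n"
proof (rule ccontr)
  let ?b = "extremal_poly j n"
  assume "\<not> degree ?b \<le> 2 * n"
  then have deg: "degree ?b = 2 * n + 1"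
    using is_extremal_extremal_poly[of j n] by (simp add: is_extremal_def)
  have "lead_coeff (pcompose ?b [:1, -1:]) = lead_coeff ?b * (-1) ^ degree ?b"
    by (subst lead_coeff_comp) auto
  then have "lead_coeff ?b = - lead_coeff ?b"
    using deg by (simp add: extremal_poly_reflect)
  then have "extremal_poly j n = 0" by simp
  with deg show False by simp
qed

theorem proposition4p2:
  assumes strong_uniqueness_conjecture
  shows uniqueness_conjecture
  unfolding uniqueness_conjecture_def
proof (intro allI impI)
  fix n j :: nat and k :: int and b :: "nat \<Rightarrow> rat"
  assume "\<exists>N. \<forall>p\<ge>N. prime p \<longrightarrow> binomial_congruence k (2 * n + 2) n b p" and j: "j \<le> n"
  then obtain N where "\<forall>p\<ge>N. prime p \<longrightarrow> binomial_congruence k (2 * n + 2) n b p"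
    by blast
  then have "{p. prime p \<and> \<not> binomial_congruence k (2 * n + 2) n b p} \<subseteq> {..<N}"
    by (auto simp: not_less[symmetric])
  then have "finite {p. prime p \<and> \<not> binomial_congruence k (2 * n + 2) n b p}"
    by (rule finite_subset) simp
  then obtain c :: "nat \<Rightarrow> rat" where "\<forall>i. int i \<le> psi (2 * n + 2) \<longrightarrow>
      (if i \<le> n then b i else 0) =
        (of_int k - 1) ^ i + c i + (-1) ^ (i + 1) * (\<Sum>l\<le>i. of_nat (i choose l) * c l)"
    using assms unfolding strong_uniqueness_conjecture_def by blast
  \<comment> \<open>Here \<open>psi (2 * n + 2)\<close> is 2n, so the relations reach beyond
    \<open>n\<close>, where the left side is 0.\<close>
  then have c: "(if i \<le> n then b i else 0) =
      (of_int k - 1) ^ i + c i - (-1) ^ i * (\<Sum>l\<le>i. of_nat (i choose l) * c l)"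
    if "i \<le> 2 * n" for i
    using that by (simp add: psi_def)
  define B where "B = pcompose (extremal_poly j n) [:1, 1:]"
  have deg: "degree B \<le> 2 * n"
    using degree_extremal_poly[of j n] by (simp add: B_def degree_pcompose)
  have B_refl: "pcompose B [:-1, -1:] = B"
  proof -
    \<comment> \<open>Both inner substitutions compose to T \<mapsto> -T.\<close>
    have "pcompose B [:-1, -1:] = pcompose (pcompose (extremal_poly j n) [:1, -1:]) [:1, 1:]"
      unfolding B_def pcompose_assoc[symmetric] by (simp add: pcompose_pCons)
    then show ?thesis by (simp add: extremal_poly_reflect B_def)
  qed
  have coeff_B: "coeff B i = (if i = j then 1 else 0)" if "i \<le> n" for i
  proof -
    obtain g where g: "extremal_poly j n = [:-1, 1:] ^ j + [:-1, 1:] ^ (n + 1) * g"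
      using is_extremal_extremal_poly[of j n] unfolding is_extremal_def cong_iff_dvd_diff
      by (metis diff_add_cancel add.commute dvdE)
    have "pcompose [:-1, 1:] [:1, 1:] = ([:0, 1:] :: rat poly)"
      by (simp add: pcompose_pCons)
    then have "B = monom 1 j + monom 1 (n + 1) * pcompose g [:1, 1:]"
      unfolding B_def g pcompose_add pcompose_mult pcompose_power
      by (simp add: monom_altdef del: power_Suc)
    with that show ?thesis
      by (simp add: coeff_monom_mult del: power_Suc)
  qed
  have "b j = (\<Sum>i\<le>n. coeff B i * b i)"
    using j by (simp add: coeff_B if_distrib[of "\<lambda>x. x * _"] cong: if_cong)
  \<comment> \<open>The unknown coefficients of \<open>B\<close> above \<open>n\<close> meet only
    zeros.\<close>
  also have "\<dots> = (\<Sum>i\<le>2 * n. coeff B i * (if i \<le> n then b i else 0))"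
    by (rule sum.mono_neutral_cong_left) auto
  also have "\<dots> = (\<Sum>i\<le>2 * n. coeff B i * (of_int k - 1) ^ i) + (\<Sum>i\<le>2 * n. coeff B i * c i)
      - (\<Sum>i\<le>2 * n. coeff B i * ((-1) ^ i * (\<Sum>l\<le>i. of_nat (i choose l) * c l)))"
    by (simp add: c algebra_simps sum.distrib sum_subtractf)
  also have "(\<Sum>i\<le>2 * n. coeff B i * ((-1) ^ i * (\<Sum>l\<le>i. of_nat (i choose l) * c l))) =
      (\<Sum>i\<le>2 * n. \<Sum>l\<le>2 * n. coeff B i * coeff ([:-1, -1:] ^ i) l * c l)"
  proof (rule sum.cong[OF refl])
    fix i assume "i \<in> {..2 * n}"
    then have "(\<Sum>l\<le>i. of_nat (i choose l) * c l) = (\<Sum>l\<le>2 * n. of_nat (i choose l) * c l)"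
      by (intro sum.mono_neutral_left) (auto simp: binomial_eq_0)
    then show "coeff B i * ((-1) ^ i * (\<Sum>l\<le>i. of_nat (i choose l) * c l)) =
        (\<Sum>l\<le>2 * n. coeff B i * coeff ([:-1, -1:] ^ i) l * c l)"
      by (simp add: coeff_reflection_power sum_distrib_left mult.assoc)
  qed
  \<comment> \<open>Collecting by \<open>c l\<close> gives L(B \<circ> \<sigma>), which cancels L(B)
    by \<open>B_refl\<close>.\<close>
  also have "\<dots> = (\<Sum>l\<le>2 * n. coeff (pcompose B [:-1, -1:]) l * c l)"
    by (subst sum.swap)
      (simp add: pcompose_sum_of_powers[OF deg] coeff_sum sum_distrib_right)
  also have "(\<Sum>i\<le>2 * n. coeff B i * (of_int k - 1) ^ i) = poly B (of_int k - 1)"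
    unfolding poly_altdef using deg
    by (intro sum.mono_neutral_right) (auto simp: coeff_eq_0)
  finally have "b j = poly B (of_int k - 1)"
    by (simp add: B_refl)
  then show "b j = poly (extremal_poly j n) (of_int k)"
    by (simp add: B_def poly_pcompose)
qed

end
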